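(* Let $n\ge 1$ and $1\le a\le n$. Then \[ T(R_{n,a,0}) = \frac{T(R_{n-1,a,0})\,T(A_n) + T(R_{n-1,a-1,0})\,T(A_n)}{T(A_{n-1})}, \] where, when $a=n$, the undefined term $T(R_{n-1,n,0})$ is interpreted as $0$.
   Context: For an integer $m\ge 0$, let $R_m$ be the bipartite graph with "white" vertices $w(i,j)$ for $0\le i,j\le m$ and "black" vertices $v(i,j)$ for $0\le i\le m-1$, $0\le j\le m+1$, where $v(i,j)$ is adjacent to $w(i',j')$ if and only if $i'\in\{i,i+1\}$ and $j'\in\{j-1,j\}$ (the dual graph of the Aztec rectangle with boundary diagonals of lengths $m$ and $m+1$). For $0\le a,b\le m$, $R_{m,a,b}$ is $R_m$ with the white vertex $w(b,a)$ deleted; thus $R_{m,a,0}$ has a hole on the boundary side $i=0$. $A_m$ denotes the order-$m$ Aztec diamond graph: white vertices $w(i,j)$, $0\le i\le m$, $0\le j\le m-1$, black vertices $v(i,j)$, $0\le i\le m-1$, $0\le j\le m$, with the same adjacency rule (this is the dual graph of the order-$m$ Aztec diamond, the union of unit lattice squares inside $|x|+|y|\le m+1$). $T(H)$ is the number of perfect matchings of $H$; the empty graph has one. *)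

theory Defs
  imports Complex_Main
begin

(* Finite simple graphs as a vertex set together with a set of two-element edge sets. *)
record 'a ugraph =
  verts :: "'a set"
  edges :: "'a set set"

definition delete_vertex :: "'a ugraph \<Rightarrow> 'a \<Rightarrow> 'a ugraph" where
  "delete_vertex G x = \<lparr> verts = verts G - {x}, edges = {e \<in> edges G. x \<notin> e} \<rparr>"

definition perfect_matching :: "'a ugraph \<Rightarrow> 'a set set \<Rightarrow> bool" where
  "perfect_matching G M \<longleftrightarrow> M \<subseteq> edges G \<and> (\<forall>x \<in> verts G. \<exists>!e. e \<in> M \<and> x \<in> e)"

definition num_perfect_matchings :: "'a ugraph \<Rightarrow> nat" where
  "num_perfect_matchings G = card {M. perfect_matching G M}"

(* White i j is w(i,j) and Black i j is v(i,j). *)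
datatype vertex = White nat nat | Black nat nat

(* v(i,j) ~ w(i',j') iff i' is i or i+1 and j' is j-1 or j.  The case j' = j-1 is written
   j = j'+1, because subtraction on nat would turn 0-1 into 0. *)
definition black_white_adj :: "nat \<times> nat \<Rightarrow> nat \<times> nat \<Rightarrow> bool" where
  "black_white_adj = (\<lambda>(i, j) (i', j'). (i' = i \<or> i' = i + 1) \<and> (j = j' + 1 \<or> j' = j))"

(* The graph with white vertices indexed by W and black vertices indexed by B. *)
definition aztec_graph :: "(nat \<times> nat) set \<Rightarrow> (nat \<times> nat) set \<Rightarrow> vertex ugraph" where
  "aztec_graph W B =
     \<lparr> verts = (\<lambda>(i, j). White i j) ` W \<union> (\<lambda>(i, j). Black i j) ` B,
       edges = {{Black i j, White i' j'} | i j i' j'.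
                  (i, j) \<in> B \<and> (i', j') \<in> W \<and> black_white_adj (i, j) (i', j')} \<rparr>"

(* R_m: the dual graph of the Aztec rectangle with boundary diagonals of lengths m and m+1. *)
definition aztec_rectangle :: "nat \<Rightarrow> vertex ugraph" where
  "aztec_rectangle m =
     aztec_graph {(i, j). i \<le> m \<and> j \<le> m} {(i, j). i < m \<and> j \<le> m + 1}"

(* R_{m,a,b}, for a, b \<le> m; the deleted vertex is w(b,a), with the indices swapped. *)
definition aztec_rectangle_hole :: "nat \<Rightarrow> nat \<Rightarrow> nat \<Rightarrow> vertex ugraph" where
  "aztec_rectangle_hole m a b = delete_vertex (aztec_rectangle m) (White b a)"

(* A_m: the dual graph of the order-m Aztec diamond; A_0 is empty. *)
definition aztec_diamond :: "nat \<Rightarrow> vertex ugraph" where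
  "aztec_diamond m =
     aztec_graph {(i, j). i \<le> m \<and> j < m} {(i, j). i < m \<and> j \<le> m}"

abbreviation T :: "'a ugraph \<Rightarrow> real" where
  "T G \<equiv> real (num_perfect_matchings G)"

end

theory Submission
  imports Defs "HOL-Library.FuncSet" "HOL-Library.Disjoint_Sets"
begin

text \<open>
  The edges of the grid split into 4-cycles (cells), and every vertex lies in one or two cells. A
  perfect matching uses from each cell \<open>c\<close> a perfect matching of some set \<open>U\<^sub>c\<close> of corners, and the
  \<open>U\<^sub>c\<close> partition the vertex set. Replacing each \<open>U\<^sub>c\<close> by its complement in \<open>c\<close> gives the same
  kind of data for a complementary vertex set, where interior vertices stay and vertices lying in
  a single cell are switched on or off (Ciucu's complementation theorem). A cell has two perfect
  matchings on all its corners, one on any edge and one on no corners, so the weights change only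
  by a power of 2, which depends on the number of cells and of black vertices. The complement of
  \<open>A\<^sub>n\<close> is a copy of \<open>A\<^bsub>n-1\<^esub>\<close> with the colours exchanged; the complement of \<open>R\<^bsub>n,a,0\<^esub>\<close> is such
  a copy of \<open>R\<^bsub>n-1\<^esub>\<close> together with the hole \<open>w(0,a)\<close>, whose two possible partners leave
  \<open>R\<^bsub>n-1,a,0\<^esub>\<close> and \<open>R\<^bsub>n-1,a-1,0\<^esub>\<close>. In both cases the power of 2 is \<open>2\<^sup>n\<close>.
\<close>

section \<open>Exact covers and edge partitions\<close>

text \<open>Perfect matchings without a graph record: a family with union \<open>V\<close> can only
  use members of \<open>E\<close> inside \<open>V\<close>, so deleting vertices changes
  \<open>V\<close> alone while \<open>E\<close> stays fixed.\<close>

definition exact_covers :: "'a set set \<Rightarrow> 'a set \<Rightarrow> 'a set set set" where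
  "exact_covers E V = {M. M \<subseteq> E \<and> \<Union>M = V \<and> disjoint M}"

lemma exact_covers_cong:
  assumes "\<And>e. e \<subseteq> V \<Longrightarrow> e \<in> E \<longleftrightarrow> e \<in> F"
  shows "exact_covers E V = exact_covers F V"
  using assms unfolding exact_covers_def by blast

lemma finite_exact_covers:
  assumes "finite V"
  shows "finite (exact_covers E V)"
proof (rule finite_subset)
  show "exact_covers E V \<subseteq> Pow (Pow V)"
    unfolding exact_covers_def by blast
qed (use assms in simp)

text \<open>\<open>F\<close> may have members outside the range of \<open>f\<close>; a cover of
  \<open>f\<close> V\<open>consists of subsets of\<close>f \<open>V\<close>, so each of its members
  is an image and pulls back to \<open>E\<close>.\<close>

lemma card_exact_covers_image:
  assumes "inj f" and E: "\<And>e. f ` e \<in> F \<longleftrightarrow> e \<in> E"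
  shows "card (exact_covers F (f ` V)) = card (exact_covers E V)"
proof -
  have inj: "inj ((`) f)"
    using assms(1) by (simp add: inj_image_eq_iff inj_def)
  have "exact_covers F (f ` V) = (`) ((`) f) ` exact_covers E V"
  proof (intro subset_antisym subsetI)
    fix M assume M: "M \<in> exact_covers F (f ` V)"
    define N where "N = {e. f ` e \<in> M}"
    have "M = (`) f ` N"
    proof (intro subset_antisym subsetI)
      fix e assume "e \<in> M"
      then have "e \<subseteq> f ` V" using M unfolding exact_covers_def by blast
      then obtain d where "e = f ` d" by (auto simp: subset_image_iff)
      then show "e \<in> (`) f ` N" using \<open>e \<in> M\<close> N_def by blast
    qed (auto simp: N_def)
    moreover have "f ` (\<Union>N) = \<Union>M"
      unfolding \<open>M = (`) f ` N\<close> by blast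
    then have "\<Union>N = V"
      using M assms(1) by (simp add: exact_covers_def inj_image_eq_iff)
    moreover have "disjoint N"
    proof (rule disjointI)
      fix a b assume ab: "a \<in> N" "b \<in> N" "a \<noteq> b"
      then have "f ` a \<in> M" "f ` b \<in> M" "f ` a \<noteq> f ` b"
        using assms(1) by (auto simp: N_def inj_image_eq_iff)
      then have "f ` a \<inter> f ` b = {}"
        using M by (auto simp: exact_covers_def disjoint_def)
      then show "a \<inter> b = {}" by blast
    qed
    moreover have "N \<subseteq> E"
      using M E by (auto simp: N_def exact_covers_def)
    ultimately show "M \<in> (`) ((`) f) ` exact_covers E V"
      by (auto simp: exact_covers_def)
  next
    fix M assume "M \<in> (`) ((`) f) ` exact_covers E V"
    then obtain N where N: "N \<in> exact_covers E V" "M = (`) f ` N" by blast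
    have "disjoint M"
      using N assms(1)
      by (auto simp: exact_covers_def disjoint_def image_Int[symmetric] inj_image_eq_iff)
    then show "M \<in> exact_covers F (f ` V)"
      using N E by (auto simp: exact_covers_def)
  qed
  moreover have "inj_on ((`) ((`) f)) (exact_covers E V)"
    using inj by (simp add: inj_image_eq_iff inj_on_def)
  ultimately show ?thesis by (simp add: card_image)
qed

text \<open>Expansion at a vertex: exactly one member \<open>e\<close> of a cover contains
  \<open>x\<close>, and removing it leaves a cover of \<open>V - e\<close>. This will resolve the
  hole vertex.\<close>

lemma card_exact_covers_at:
  assumes "finite V" "x \<in> V"
  shows "card (exact_covers E V)
    = (\<Sum>e | e \<in> E \<and> x \<in> e \<and> e \<subseteq> V. card (exact_covers E (V - e)))"
proof -
  let ?A = "{e. e \<in> E \<and> x \<in> e \<and> e \<subseteq> V}"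
  have fin: "finite ?A"
    by (rule finite_subset[of _ "Pow V"]) (use assms in auto)
  have "exact_covers E V = (\<Union>e\<in>?A. insert e ` exact_covers E (V - e))"
  proof (intro subset_antisym subsetI)
    fix M assume M: "M \<in> exact_covers E V"
    then obtain e where e: "e \<in> M" "x \<in> e"
      using assms(2) unfolding exact_covers_def by blast
    have "d \<inter> e = {}" if "d \<in> M - {e}" for d
      using M e(1) that by (auto simp: exact_covers_def disjoint_def)
    then have "\<Union>(M - {e}) = \<Union>M - e" by blast
    moreover have "disjoint (M - {e})"
      using M by (auto simp: exact_covers_def disjoint_def)
    ultimately have "M - {e} \<in> exact_covers E (V - e)"
      using M by (auto simp: exact_covers_def)
    then have "insert e (M - {e}) \<in> insert e ` exact_covers E (V - e)" by (rule imageI)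
    then have "M \<in> insert e ` exact_covers E (V - e)" using e(1) by (simp add: insert_absorb)
    moreover have "e \<in> ?A" using M e by (auto simp: exact_covers_def)
    ultimately show "M \<in> (\<Union>e\<in>?A. insert e ` exact_covers E (V - e))" by (rule UN_I[rotated])
  next
    fix M assume "M \<in> (\<Union>e\<in>?A. insert e ` exact_covers E (V - e))"
    then obtain e N where e: "e \<in> ?A" and N: "N \<in> exact_covers E (V - e)" "M = insert e N"
      by blast
    have N': "d \<subseteq> V - e" if "d \<in> N" for d
      using N(1) that by (auto simp: exact_covers_def)
    then have "d \<inter> e = {}" "e \<inter> d = {}" if "d \<in> N" for d using that by blast+
    moreover have "disjoint N" using N(1) by (simp add: exact_covers_def)
    ultimately have "disjoint M"
      unfolding N(2) disjoint_def by (metis insert_iff)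
    moreover have "\<Union>N = V - e" using N(1) by (simp add: exact_covers_def)
    then have "\<Union>M = V" using e by (auto simp: N(2))
    ultimately show "M \<in> exact_covers E V"
      using N e by (auto simp: exact_covers_def)
  qed
  moreover have "card (\<Union>e\<in>?A. insert e ` exact_covers E (V - e))
      = (\<Sum>e\<in>?A. card (insert e ` exact_covers E (V - e)))"
  proof (rule card_UN_disjoint[OF fin])
    show "\<forall>e\<in>?A. finite (insert e ` exact_covers E (V - e))"
      using assms(1) by (simp add: finite_exact_covers)
    show "\<forall>e\<in>?A. \<forall>d\<in>?A. e \<noteq> d \<longrightarrow>
        insert e ` exact_covers E (V - e) \<inter> insert d ` exact_covers E (V - d) = {}"
    proof (intro ballI impI equals0I)
      fix e d M
      assume e: "e \<in> ?A" "d \<in> ?A" "e \<noteq> d"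
        and "M \<in> insert e ` exact_covers E (V - e) \<inter> insert d ` exact_covers E (V - d)"
      then obtain N where N: "e \<in> M" "N \<in> exact_covers E (V - d)" "M = insert d N" by blast
      then have "e \<in> N" using e(3) by blast
      then have "e \<subseteq> V - d" using N(2) by (auto simp: exact_covers_def)
      then show False using e by blast
    qed
  qed
  moreover have "card (insert e ` exact_covers E (V - e)) = card (exact_covers E (V - e))"
    if "e \<in> ?A" for e
  proof (rule card_image, rule inj_onI)
    fix M N assume *: "M \<in> exact_covers E (V - e)" "N \<in> exact_covers E (V - e)"
      "insert e M = insert e N"
    \<comment> \<open>\<open>x\<close> lies in \<open>e\<close> but not in \<open>V - e\<close>, so
      \<open>e\<close> is no member of a cover of \<open>V - e\<close> and can be cancelled from
      \<open>insert e M\<close>.\<close>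
    have "e \<notin> K" if "\<Union>K = V - e" for K using that \<open>e \<in> ?A\<close> by blast
    then have "e \<notin> M" "e \<notin> N" using *(1,2) by (simp_all add: exact_covers_def)
    then show "M = N" using *(3) by (simp add: insert_ident)
  qed
  ultimately show ?thesis by simp
qed

text \<open>\<open>U q\<close> is the set of vertices that a matching covers by edges of class
  \<open>q\<close>. An indexed family, since many \<open>U q\<close> may be empty; extensional, so
  that it is determined by its values on \<open>I\<close> and maps between splittings can be
  bijections.\<close>

definition splittings :: "('i \<Rightarrow> 'a set) \<Rightarrow> 'i set \<Rightarrow> 'a set \<Rightarrow> ('i \<Rightarrow> 'a set) set" where
  "splittings C I V =
     {U \<in> (\<Pi>\<^sub>E q\<in>I. Pow (C q)). (\<Union>q\<in>I. U q) = V \<and> disjoint_family_on U I}"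

lemma finite_splittings:
  assumes "finite I" "finite V"
  shows "finite (splittings C I V)"
proof (rule finite_subset)
  show "splittings C I V \<subseteq> (\<Pi>\<^sub>E q\<in>I. Pow V)"
  proof
    fix U assume "U \<in> splittings C I V"
    then have "U q \<subseteq> V" if "q \<in> I" for q using that by (auto simp: splittings_def)
    moreover have "U \<in> extensional I"
      using \<open>U \<in> _\<close> by (simp add: splittings_def PiE_iff)
    ultimately show "U \<in> (\<Pi>\<^sub>E q\<in>I. Pow V)" by (simp add: PiE_iff)
  qed
  show "finite (\<Pi>\<^sub>E q\<in>I. Pow V)"
    using assms by (intro finite_PiE) auto
qed

text \<open>Sorting the edges of a cover by class gives a splitting together with a cover of each
  part by its own class, and these data glue back uniquely. The sum runs over the splittings, the
  product over the independent choices per class.\<close>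

lemma card_exact_covers_UN:
  assumes "finite I" "finite V" and disj: "disjoint_family_on E I"
  shows "card (exact_covers (\<Union>q\<in>I. E q) V)
    = (\<Sum>U\<in>splittings (\<lambda>q. \<Union>(E q)) I V. \<Prod>q\<in>I. card (exact_covers (E q) (U q)))"
proof -
  let ?S = "splittings (\<lambda>q. \<Union>(E q)) I V"
  let ?P = "\<lambda>U. \<Pi>\<^sub>E q\<in>I. exact_covers (E q) (U q)"
  \<comment> \<open>\<open>f\<close> sorts a cover into its classes and records their unions;
    \<open>g\<close> glues the classes.\<close>
  define f where "f M = ((\<lambda>q\<in>I. \<Union>(M \<inter> E q)), (\<lambda>q\<in>I. M \<inter> E q))" for M
  define g where "g = (\<lambda>(U :: 'a \<Rightarrow> 'b set, F). \<Union>q\<in>I. F q :: 'b set set)"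
  have "bij_betw f (exact_covers (\<Union>q\<in>I. E q) V) (Sigma ?S ?P)"
  proof (rule bij_betwI[where g = g])
    show "f \<in> exact_covers (\<Union>q\<in>I. E q) V \<rightarrow> Sigma ?S ?P"
    proof
      fix M assume M: "M \<in> exact_covers (\<Union>q\<in>I. E q) V"
      have "disjoint_family_on (\<lambda>q\<in>I. \<Union>(M \<inter> E q)) I"
        unfolding disjoint_family_on_def
      proof (intro ballI impI)
        fix p q assume pq: "p \<in> I" "q \<in> I" "p \<noteq> q"
        have "a \<inter> b = {}" if "a \<in> M \<inter> E p" "b \<in> M \<inter> E q" for a b
        proof (rule disjointD)
          show "disjoint M" using M by (simp add: exact_covers_def)
          show "a \<noteq> b" using disj pq that by (auto simp: disjoint_family_on_def)
        qed (use that in simp_all)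
        then have "\<Union>(M \<inter> E p) \<inter> \<Union>(M \<inter> E q) = {}" by blast
        then show "(\<lambda>q\<in>I. \<Union>(M \<inter> E q)) p \<inter> (\<lambda>q\<in>I. \<Union>(M \<inter> E q)) q = {}"
          using pq by simp
      qed
      moreover have "(\<Union>q\<in>I. (\<lambda>q\<in>I. \<Union>(M \<inter> E q)) q) = V"
        using M by (fastforce simp: exact_covers_def)
      ultimately have "(\<lambda>q\<in>I. \<Union>(M \<inter> E q)) \<in> ?S"
        by (auto simp: splittings_def)
      moreover have "(\<lambda>q\<in>I. M \<inter> E q) \<in> ?P (\<lambda>q\<in>I. \<Union>(M \<inter> E q))"
        using M by (auto simp: exact_covers_def disjoint_def)
      ultimately show "f M \<in> Sigma ?S ?P" by (simp add: f_def)
    qed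
    show "g \<in> Sigma ?S ?P \<rightarrow> exact_covers (\<Union>q\<in>I. E q) V"
    proof
      fix z assume "z \<in> Sigma ?S ?P"
      then obtain U F where z: "z = (U, F)" and U: "U \<in> ?S" and F: "F \<in> ?P U" by blast
      have F': "F q \<subseteq> E q" "\<Union>(F q) = U q" "disjoint (F q)" if "q \<in> I" for q
        using F that by (auto simp: PiE_iff exact_covers_def)
      have "\<Union>(\<Union>q\<in>I. F q) = (\<Union>q\<in>I. U q)" using F'(2) by blast
      then have "\<Union>(\<Union>q\<in>I. F q) = V" using U by (simp add: splittings_def)
      \<comment> \<open>Two edges of one class are disjoint because \<open>F q\<close> is a cover;
        edges of different classes lie in different parts of the splitting.\<close>
      moreover have "disjoint (\<Union>q\<in>I. F q)"
      proof (rule disjointI)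
        fix a b assume "a \<in> (\<Union>q\<in>I. F q)" "b \<in> (\<Union>q\<in>I. F q)" "a \<noteq> b"
        then obtain p q where pq: "p \<in> I" "q \<in> I" "a \<in> F p" "b \<in> F q" by blast
        show "a \<inter> b = {}"
        proof (cases "p = q")
          case True
          then show ?thesis using F'(3) pq \<open>a \<noteq> b\<close> by (auto simp: disjoint_def)
        next
          case False
          then have "U p \<inter> U q = {}"
            using U pq by (auto simp: splittings_def disjoint_family_on_def)
          then show ?thesis using F'(2) pq by blast
        qed
      qed
      ultimately show "g z \<in> exact_covers (\<Union>q\<in>I. E q) V"
        using F'(1) by (auto simp: exact_covers_def g_def z)
    qed
    show "g (f M) = M" if "M \<in> exact_covers (\<Union>q\<in>I. E q) V" for M
      using that by (auto simp: exact_covers_def f_def g_def)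
    show "f (g z) = z" if "z \<in> Sigma ?S ?P" for z
    proof -
      obtain U F where z: "z = (U, F)" and U: "U \<in> ?S" and F: "F \<in> ?P U" using \<open>z \<in> _\<close> by blast
      have F': "F q \<subseteq> E q" "\<Union>(F q) = U q" if "q \<in> I" for q
        using F that by (auto simp: PiE_iff exact_covers_def)
      \<comment> \<open>Disjointness of the classes is what lets \<open>F q\<close> be recovered
        from the glued family.\<close>
      have *: "(\<Union>p\<in>I. F p) \<inter> E q = F q" if "q \<in> I" for q
      proof -
        have "F p \<inter> E q = {}" if "p \<in> I" "p \<noteq> q" for p
          using F'(1)[OF that(1)] disj that \<open>q \<in> I\<close> unfolding disjoint_family_on_def by blast
        then show ?thesis using F'(1)[OF that] that by blast
      qed
      have "(\<lambda>q\<in>I. (\<Union>p\<in>I. F p) \<inter> E q) = F"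
        using F by (intro ext) (auto simp: * restrict_def PiE_iff extensional_def)
      moreover have "(\<lambda>q\<in>I. \<Union>((\<Union>p\<in>I. F p) \<inter> E q)) = U"
        using U F'(2)
        by (intro ext) (simp add: * restrict_def PiE_iff extensional_def splittings_def)
      ultimately show ?thesis by (simp add: f_def g_def z)
    qed
  qed
  then have "card (exact_covers (\<Union>q\<in>I. E q) V) = card (Sigma ?S ?P)"
    by (rule bij_betw_same_card)
  also have "\<dots> = (\<Sum>U\<in>?S. card (?P U))"
  proof (rule card_SigmaI)
    show "finite ?S" using assms by (simp add: finite_splittings)
    show "\<forall>U\<in>?S. finite (?P U)"
    proof
      fix U assume "U \<in> ?S"
      then have "U q \<subseteq> V" if "q \<in> I" for q using that by (auto simp: splittings_def)
      then show "finite (?P U)"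
        using assms by (intro finite_PiE finite_exact_covers) (auto intro: finite_subset)
    qed
  qed
  also have "\<dots> = (\<Sum>U\<in>?S. \<Prod>q\<in>I. card (exact_covers (E q) (U q)))"
    using assms(1) by (simp add: card_PiE)
  finally show ?thesis .
qed

section \<open>Complementation\<close>

text \<open>Expressing a partition by the number of parts through each point turns complementation
  into a subtraction of numbers.\<close>

lemma splittings_iff_card:
  assumes "finite I"
  shows "U \<in> splittings C I V \<longleftrightarrow>
    U \<in> (\<Pi>\<^sub>E q\<in>I. Pow (C q)) \<and> (\<forall>x. card {q \<in> I. x \<in> U q} = of_bool (x \<in> V))"
proof -
  have "(\<Union>q\<in>I. U q) = V \<and> disjoint_family_on U I"
    if card: "\<And>x. card {q \<in> I. x \<in> U q} = of_bool (x \<in> V)"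
  proof
    show "(\<Union>q\<in>I. U q) = V"
    proof (rule set_eqI)
      fix x
      have "x \<in> V \<longleftrightarrow> card {q \<in> I. x \<in> U q} \<noteq> 0" by (simp add: card)
      also have "\<dots> \<longleftrightarrow> {q \<in> I. x \<in> U q} \<noteq> {}" using assms by simp
      finally show "x \<in> (\<Union>q\<in>I. U q) \<longleftrightarrow> x \<in> V" by blast
    qed
    show "disjoint_family_on U I"
      unfolding disjoint_family_on_def
    proof (intro ballI impI equals0I)
      fix p q x assume pq: "p \<in> I" "q \<in> I" "p \<noteq> q" "x \<in> U p \<inter> U q"
      then have "card {p, q} \<le> card {q \<in> I. x \<in> U q}"
        using assms by (intro card_mono) auto
      then show False using pq(3) by (simp add: card of_bool_def split: if_splits)
    qed
  qed
  moreover have "card {q \<in> I. x \<in> U q} = of_bool (x \<in> V)"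
    if "(\<Union>q\<in>I. U q) = V" "disjoint_family_on U I" for x
  proof (cases "x \<in> V")
    case True
    then have "x \<in> (\<Union>q\<in>I. U q)" using that(1) by simp
    then obtain p where p: "p \<in> I" "x \<in> U p" by blast
    then have "{q \<in> I. x \<in> U q} = {p}"
      using that(2) unfolding disjoint_family_on_def by blast
    then show ?thesis using True by simp
  next
    case False
    then have "{q \<in> I. x \<in> U q} = {}" using that(1) by blast
    then show ?thesis using False by (simp only: card.empty of_bool_eq)
  qed
  ultimately show ?thesis unfolding splittings_def by blast
qed

text \<open>A point \<open>x\<close> lies in \<open>[x \<in> V] + [x \<in> V']\<close> of the sets
  \<open>C q\<close>. If \<open>[x \<in> V]\<close> of these have it in \<open>U q\<close>, then
  \<open>[x \<in> V']\<close> have it in \<open>C q - U q\<close>. The hypothesis is symmetric in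
  \<open>V\<close> and \<open>V'\<close>, and complementing twice is the identity.\<close>

lemma bij_betw_splittings_complement:
  assumes "finite I"
    and cov: "\<And>x. card {q \<in> I. x \<in> C q} = of_bool (x \<in> V) + of_bool (x \<in> V')"
  shows "bij_betw (\<lambda>U. \<lambda>q\<in>I. C q - U q) (splittings C I V) (splittings C I V')"
proof -
  have main: "(\<lambda>q\<in>I. C q - U q) \<in> splittings C I Y"
    if "U \<in> splittings C I X"
      and cov: "\<And>x. card {q \<in> I. x \<in> C q} = of_bool (x \<in> X) + of_bool (x \<in> Y)" for U X Y
  proof -
    have U: "U \<in> (\<Pi>\<^sub>E q\<in>I. Pow (C q))" "card {q \<in> I. x \<in> U q} = of_bool (x \<in> X)" for x
      using that(1) by (simp_all add: splittings_iff_card[OF assms(1)])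
    have "card {q \<in> I. x \<in> (\<lambda>q\<in>I. C q - U q) q} = of_bool (x \<in> Y)" for x
    proof -
      have "{q \<in> I. x \<in> (\<lambda>q\<in>I. C q - U q) q} = {q \<in> I. x \<in> C q} - {q \<in> I. x \<in> U q}"
        by auto
      moreover have "{q \<in> I. x \<in> U q} \<subseteq> {q \<in> I. x \<in> C q}"
        using U(1) by (auto simp: PiE_iff)
      ultimately show ?thesis
        using assms(1) by (simp add: card_Diff_subset cov U(2))
    qed
    then show ?thesis by (auto simp: splittings_iff_card[OF assms(1)])
  qed
  have inv: "(\<lambda>q\<in>I. C q - (\<lambda>q\<in>I. C q - U q) q) = U" if "U \<in> splittings C I X" for U X
    using that by (intro ext) (auto simp: splittings_def PiE_iff extensional_def restrict_def)
  show ?thesis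
  proof (rule bij_betwI[where g = "\<lambda>U. \<lambda>q\<in>I. C q - U q"])
    show "(\<lambda>U. \<lambda>q\<in>I. C q - U q) \<in> splittings C I V \<rightarrow> splittings C I V'"
      by (rule funcsetI, rule main[OF _ cov])
    show "(\<lambda>U. \<lambda>q\<in>I. C q - U q) \<in> splittings C I V' \<rightarrow> splittings C I V"
      by (rule funcsetI, rule main) (simp_all add: cov)
  qed (fact inv)+
qed

text \<open>The local identity \<open>loc\<close> is multiplied over all classes. The sets
  \<open>U q \<inter> B\<close> partition \<open>V \<inter> B\<close>, so the exponents add up to a
  number that does not depend on the splitting and can be pulled out of the sum.\<close>

lemma complementation:
  assumes "finite I" "finite V" "finite V'" "disjoint_family_on E I"
    and cov: "\<And>x. card {q \<in> I. x \<in> \<Union>(E q)} = of_bool (x \<in> V) + of_bool (x \<in> V')"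
    and loc: "\<And>q U. q \<in> I \<Longrightarrow> U \<subseteq> \<Union>(E q) \<Longrightarrow>
      2 * card (exact_covers (E q) U)
        = 2 ^ card (U \<inter> B) * card (exact_covers (E q) (\<Union>(E q) - U))"
  shows "2 ^ card I * card (exact_covers (\<Union>q\<in>I. E q) V)
    = 2 ^ card (V \<inter> B) * card (exact_covers (\<Union>q\<in>I. E q) V')"
proof -
  let ?C = "\<lambda>q. \<Union>(E q)"
  let ?w = "\<lambda>U. \<Prod>q\<in>I. card (exact_covers (E q) (U q))"
  have "2 ^ card I * ?w U = 2 ^ card (V \<inter> B) * ?w (\<lambda>q\<in>I. ?C q - U q)"
    if "U \<in> splittings ?C I V" for U
  proof -
    have U: "\<And>q. q \<in> I \<Longrightarrow> U q \<subseteq> ?C q" "(\<Union>q\<in>I. U q) = V" "disjoint_family_on U I"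
      using that by (auto simp: splittings_def PiE_iff)
    have "finite (U q)" if "q \<in> I" for q
      using that U(2) assms(2) by (auto intro: finite_subset)
    then have "card (\<Union>q\<in>I. U q \<inter> B) = (\<Sum>q\<in>I. card (U q \<inter> B))"
      using assms(1) U(3) by (intro card_UN_disjoint) (auto simp: disjoint_family_on_def)
    moreover have "(\<Union>q\<in>I. U q \<inter> B) = V \<inter> B" using U(2) by blast
    ultimately have cVB: "card (V \<inter> B) = (\<Sum>q\<in>I. card (U q \<inter> B))" by simp
    have "2 ^ card I * ?w U = (\<Prod>q\<in>I. 2 * card (exact_covers (E q) (U q)))"
      by (simp add: prod.distrib)
    also have "\<dots> = (\<Prod>q\<in>I. 2 ^ card (U q \<inter> B) * card (exact_covers (E q) (?C q - U q)))"
      using loc U(1) by (intro prod.cong) auto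
    also have "\<dots> = 2 ^ card (V \<inter> B) * ?w (\<lambda>q\<in>I. ?C q - U q)"
      by (simp add: prod.distrib cVB power_sum)
    finally show ?thesis .
  qed
  then have "2 ^ card I * (\<Sum>U\<in>splittings ?C I V. ?w U)
      = 2 ^ card (V \<inter> B) * (\<Sum>U\<in>splittings ?C I V. ?w (\<lambda>q\<in>I. ?C q - U q))"
    by (simp add: sum_distrib_left)
  \<comment> \<open>Complementation is a bijection of splittings, so it reindexes the sum.\<close>
  also have "(\<Sum>U\<in>splittings ?C I V. ?w (\<lambda>q\<in>I. ?C q - U q))
      = (\<Sum>U\<in>splittings ?C I V'. ?w U)"
    using bij_betw_splittings_complement[OF assms(1) cov] by (rule sum.reindex_bij_betw)
  finally show ?thesis
    using assms by (simp add: card_exact_covers_UN)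
qed

section \<open>The local identity on a 4-cycle\<close>

lemma exact_covers_square:
  assumes dist: "distinct [s, t, l, r]" and U: "U \<subseteq> {s, t, l, r}"
  shows "exact_covers {{l, s}, {r, s}, {l, t}, {r, t}} U =
    (if s \<notin> U \<and> t \<notin> U \<and> l \<notin> U \<and> r \<notin> U then {{}} else {}) \<union>
    (if s \<in> U \<and> t \<notin> U \<and> l \<in> U \<and> r \<notin> U then {{{l, s}}} else {}) \<union>
    (if s \<in> U \<and> t \<notin> U \<and> l \<notin> U \<and> r \<in> U then {{{r, s}}} else {}) \<union>
    (if s \<notin> U \<and> t \<in> U \<and> l \<in> U \<and> r \<notin> U then {{{l, t}}} else {}) \<union>
    (if s \<notin> U \<and> t \<in> U \<and> l \<notin> U \<and> r \<in> U then {{{r, t}}} else {}) \<union>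
    (if s \<in> U \<and> t \<in> U \<and> l \<in> U \<and> r \<in> U
      then {{{r, s}, {l, t}}, {{l, s}, {r, t}}} else {})"
    (is "exact_covers ?E U = ?R")
proof -
  let ?c = "{s, t, l, r}"
  let ?X = "{{}, {{l, s}}, {{r, s}}, {{l, t}}, {{r, t}}, {{l, s}, {r, t}}, {{r, s}, {l, t}}}"
  \<comment> \<open>Evaluates a filter on an explicitly listed set one element at a time.\<close>
  have filter_insert: "{M \<in> insert Y A. P M} = (if P Y then {Y} else {}) \<union> {M \<in> A. P M}"
    for Y :: "'a set set" and A P by auto
  have ds: "s \<noteq> t" "s \<noteq> l" "s \<noteq> r" "t \<noteq> l" "t \<noteq> r" "l \<noteq> r"
    "t \<noteq> s" "l \<noteq> s" "r \<noteq> s" "l \<noteq> t" "r \<noteq> t" "r \<noteq> l"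
    using dist by auto
  \<comment> \<open>The edges of a 4-cycle in the abstract: \<open>a\<close>, \<open>d\<close> and
    \<open>b\<close>, \<open>c\<close> are the opposite pairs, and all other pairs meet. So a
    matching has at most one edge or is an opposite pair.\<close>
  have *: "disjoint M \<longleftrightarrow> M \<in> {{}, {a}, {b}, {c}, {d}, {a, d}, {b, c}}"
    if "M \<subseteq> {a, b, c, d}" "a \<inter> b \<noteq> {}" "a \<inter> c \<noteq> {}" "b \<inter> d \<noteq> {}" "c \<inter> d \<noteq> {}"
      "a \<inter> d = {}" "b \<inter> c = {}" "distinct [a, b, c, d]" for M and a b c d :: "'a set"
  proof
    assume "disjoint M"
    then have D: "\<not> (e \<in> M \<and> f \<in> M)" if "e \<noteq> f" "e \<inter> f \<noteq> {}" for e f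
      using that disjointD by blast
    have n: "\<not> (a \<in> M \<and> b \<in> M)" "\<not> (a \<in> M \<and> c \<in> M)" "\<not> (b \<in> M \<and> d \<in> M)"
      "\<not> (c \<in> M \<and> d \<in> M)"
      using that by (intro D; simp)+
    have "M \<in> Pow {a, b, c, d}" using that(1) by simp
    then show "M \<in> {{}, {a}, {b}, {c}, {d}, {a, d}, {b, c}}"
      unfolding Pow_insert using n by (elim UnE imageE; simp)
  next
    assume "M \<in> {{}, {a}, {b}, {c}, {d}, {a, d}, {b, c}}"
    then show "disjoint M"
      using that(6,7) by (auto simp: disjoint_def)
  qed
  have dj: "disjoint M \<longleftrightarrow> M \<in> ?X" if "M \<subseteq> ?E" for M
    by (rule *[OF that]) (simp_all add: doubleton_eq_iff ds)
  have "exact_covers ?E U = {M \<in> ?X. M \<subseteq> ?E \<and> \<Union>M = U}"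
    using dj unfolding exact_covers_def by (intro Collect_cong) (metis (no_types, lifting))
  \<comment> \<open>Every candidate stays within the four corners, so its union can be compared with
    \<open>U\<close> corner by corner, leaving a finite evaluation.\<close>
  also have "\<dots> = {M \<in> ?X. \<forall>x\<in>?c. x \<in> \<Union>M \<longleftrightarrow> x \<in> U}"
  proof (intro Collect_cong conj_cong refl)
    fix M assume "M \<in> ?X"
    then have "M \<subseteq> ?E" "\<Union>M \<subseteq> ?c" by auto
    then show "M \<subseteq> ?E \<and> \<Union>M = U \<longleftrightarrow> (\<forall>x\<in>?c. x \<in> \<Union>M \<longleftrightarrow> x \<in> U)"
      using U by blast
  qed
  also have "\<dots> = ?R"
    unfolding filter_insert
    by (cases "s \<in> U"; cases "t \<in> U"; cases "l \<in> U"; cases "r \<in> U")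
      (simp_all add: ds)
  finally show ?thesis .
qed

text \<open>\<open>l\<close> and \<open>r\<close> are the black corners. For all four corners the
  identity reads 2 * 2 = 4 * 1, for the ends of one edge 2 * 1 = 2 * 1, for no corner 2 * 1 = 1 * 2.
  Any other \<open>U\<close> has unequal numbers of black and white corners, as has its complement,
  and both sides vanish.\<close>

lemma card_exact_covers_square:
  assumes dist: "distinct [s, t, l, r]" and U: "U \<subseteq> {s, t, l, r}"
    and B: "B \<inter> {s, t, l, r} = {l, r}"
  defines "E \<equiv> {{l, s}, {r, s}, {l, t}, {r, t}}"
  shows "2 * card (exact_covers E U)
    = 2 ^ card (U \<inter> B) * card (exact_covers E ({s, t, l, r} - U))"
proof -
  have "U \<inter> B = U \<inter> {l, r}" using U B by blast
  also have "\<dots> = (if l \<in> U then {l} else {}) \<union> (if r \<in> U then {r} else {})"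
    by auto
  finally have UB: "U \<inter> B = \<dots>" .
  show ?thesis
    unfolding E_def UB exact_covers_square[OF dist U] exact_covers_square[OF dist Diff_subset]
    using dist not_sym[of l r]
    by (cases "s \<in> U"; cases "t \<in> U"; cases "l \<in> U"; cases "r \<in> U")
      (simp_all add: card_insert_if doubleton_eq_iff)
qed

section \<open>Induced subgraphs of the grid\<close>

text \<open>One infinite host graph: all graphs considered here are induced subgraphs of it, so
  their matchings are covers drawn from this single edge set.\<close>

definition grid_edges :: "vertex set set" where
  "grid_edges = {{Black i j, White i' j'} | i j i' j'. black_white_adj (i, j) (i', j')}"

lemma num_perfect_matchings_induced:
  assumes "edges G = {e \<in> E. e \<subseteq> verts G}"
  shows "num_perfect_matchings G = card (exact_covers E (verts G))"
proof -
  have "perfect_matching G M \<longleftrightarrow> M \<in> exact_covers E (verts G)" for M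
  proof
    assume M: "perfect_matching G M"
    then have sub: "M \<subseteq> E" "\<And>e. e \<in> M \<Longrightarrow> e \<subseteq> verts G"
      using assms by (auto simp: perfect_matching_def)
    moreover have "disjoint M"
    proof (rule disjointI, rule equals0I)
      fix e f x assume ef: "e \<in> M" "f \<in> M" "e \<noteq> f" "x \<in> e \<inter> f"
      then have "x \<in> verts G" using sub(2) by blast
      then have "\<exists>!e. e \<in> M \<and> x \<in> e" using M by (simp add: perfect_matching_def)
      then show False using ef by blast
    qed
    moreover have "\<Union>M = verts G"
    proof
      show "verts G \<subseteq> \<Union>M"
      proof
        fix x assume "x \<in> verts G"
        then have "\<exists>!e. e \<in> M \<and> x \<in> e" using M by (simp add: perfect_matching_def)
        then show "x \<in> \<Union>M" by blast
      qed
    qed (use sub(2) in blast)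
    ultimately show "M \<in> exact_covers E (verts G)" by (simp add: exact_covers_def)
  next
    assume M: "M \<in> exact_covers E (verts G)"
    have "\<exists>!e. e \<in> M \<and> x \<in> e" if x: "x \<in> verts G" for x
    proof -
      have "x \<in> \<Union>M" using M x by (simp add: exact_covers_def)
      then obtain e where e: "e \<in> M" "x \<in> e" by blast
      have "f = e" if "f \<in> M" "x \<in> f" for f
        using M e that disjointD[of M e f] by (auto simp: exact_covers_def)
      then show ?thesis using e by blast
    qed
    moreover have "M \<subseteq> edges G" using M assms by (auto simp: exact_covers_def)
    ultimately show "perfect_matching G M" by (simp add: perfect_matching_def)
  qed
  then show ?thesis by (simp add: num_perfect_matchings_def)
qed

lemma verts_aztec_graph_simps [simp]:
  "White i j \<in> verts (aztec_graph W B) \<longleftrightarrow> (i, j) \<in> W"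
  "Black i j \<in> verts (aztec_graph W B) \<longleftrightarrow> (i, j) \<in> B"
  by (auto simp: aztec_graph_def)

lemma vertex_set_eqI:
  assumes "\<And>i j. White i j \<in> X \<longleftrightarrow> White i j \<in> Y"
    and "\<And>i j. Black i j \<in> X \<longleftrightarrow> Black i j \<in> Y"
  shows "X = Y"
proof (rule set_eqI)
  show "x \<in> X \<longleftrightarrow> x \<in> Y" for x
    using assms by (cases x) auto
qed

lemma edges_aztec_graph:
  "edges (aztec_graph W B) = {e \<in> grid_edges. e \<subseteq> verts (aztec_graph W B)}"
proof (intro subset_antisym subsetI)
  fix e assume "e \<in> edges (aztec_graph W B)"
  then obtain i j k l where "e = {Black i j, White k l}" "(i, j) \<in> B" "(k, l) \<in> W"
    "black_white_adj (i, j) (k, l)"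
    by (auto simp: aztec_graph_def)
  then show "e \<in> {e \<in> grid_edges. e \<subseteq> verts (aztec_graph W B)}"
    by (auto simp: grid_edges_def)
next
  fix e assume "e \<in> {e \<in> grid_edges. e \<subseteq> verts (aztec_graph W B)}"
  then obtain i j k l where "e = {Black i j, White k l}" "(i, j) \<in> B" "(k, l) \<in> W"
    "black_white_adj (i, j) (k, l)"
    by (auto simp: grid_edges_def)
  then show "e \<in> edges (aztec_graph W B)"
    by (auto simp: aztec_graph_def)
qed

lemma num_perfect_matchings_aztec_graph:
  "num_perfect_matchings (aztec_graph W B)
    = card (exact_covers grid_edges (verts (aztec_graph W B)))"
  by (intro num_perfect_matchings_induced edges_aztec_graph)

lemma delete_White_aztec_graph:
  "delete_vertex (aztec_graph W B) (White i j) = aztec_graph (W - {(i, j)}) B"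
proof -
  have v: "verts (aztec_graph W B) - {White i j} = verts (aztec_graph (W - {(i, j)}) B)"
    by (rule vertex_set_eqI) auto
  have "{e \<in> edges (aztec_graph W B). White i j \<notin> e} = edges (aztec_graph (W - {(i, j)}) B)"
    unfolding edges_aztec_graph v[symmetric] by blast
  then show ?thesis
    unfolding delete_vertex_def v by simp
qed

text \<open>With \<open>w(i,j)\<close> placed at (2i, 2j+1) and \<open>v(i,j)\<close> at (2i+1, 2j),
  neighbours differ by one in each coordinate. In this picture \<open>shift\<close> is translation
  by (1,1), which preserves adjacency and exchanges the colours.\<close>

primrec shift :: "vertex \<Rightarrow> vertex" where
  "shift (White i j) = Black i (j + 1)"
| "shift (Black i j) = White (i + 1) j"

lemma inj_shift: "inj shift"
proof (rule injI)
  show "x = y" if "shift x = shift y" for x y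
    using that by (cases x; cases y) auto
qed

text \<open>The bound \<open>1 \<le> i\<close> excludes the vertices outside the range of
  \<open>shift\<close>, where truncated subtraction would name a false preimage.\<close>

lemma White_in_shift: "White i j \<in> shift ` V \<longleftrightarrow> 1 \<le> i \<and> Black (i - 1) j \<in> V"
proof
  assume "White i j \<in> shift ` V"
  then obtain x where "x \<in> V" "White i j = shift x" by blast
  then show "1 \<le> i \<and> Black (i - 1) j \<in> V" by (cases x) auto
next
  assume "1 \<le> i \<and> Black (i - 1) j \<in> V"
  then show "White i j \<in> shift ` V" by (intro image_eqI[where x = "Black (i - 1) j"]) auto
qed

lemma Black_in_shift: "Black i j \<in> shift ` V \<longleftrightarrow> 1 \<le> j \<and> White i (j - 1) \<in> V"
proof
  assume "Black i j \<in> shift ` V"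
  then obtain x where "x \<in> V" "Black i j = shift x" by blast
  then show "1 \<le> j \<and> White i (j - 1) \<in> V" by (cases x) auto
next
  assume "1 \<le> j \<and> White i (j - 1) \<in> V"
  then show "Black i j \<in> shift ` V" by (intro image_eqI[where x = "White i (j - 1)"]) auto
qed

lemma shift_image_grid_edges: "shift ` e \<in> grid_edges \<longleftrightarrow> e \<in> grid_edges"
proof
  assume "e \<in> grid_edges"
  then obtain i j k l where "e = {Black i j, White k l}" "black_white_adj (i, j) (k, l)"
    by (auto simp: grid_edges_def)
  then have "shift ` e = {Black k (l + 1), White (i + 1) j}"
    "black_white_adj (k, l + 1) (i + 1, j)"
    by (auto simp: black_white_adj_def)
  then show "shift ` e \<in> grid_edges" unfolding grid_edges_def by blast
next
  assume "shift ` e \<in> grid_edges"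
  then obtain i j k l where e: "shift ` e = {Black i j, White k l}"
    and adj: "black_white_adj (i, j) (k, l)"
    by (auto simp: grid_edges_def)
  have "Black i j \<in> shift ` e" "White k l \<in> shift ` e" using e by simp_all
  \<comment> \<open>Both ends are images, which keeps them off the border and makes the subtractions
    below exact.\<close>
  then have "1 \<le> j" "1 \<le> k" by (simp_all add: Black_in_shift White_in_shift)
  then have "shift ` e = shift ` {Black (k - 1) l, White i (j - 1)}" using e by auto
  then have "e = {Black (k - 1) l, White i (j - 1)}"
    using inj_shift by (simp only: inj_image_eq_iff)
  moreover have "black_white_adj (k - 1, l) (i, j - 1)"
    using adj \<open>1 \<le> j\<close> \<open>1 \<le> k\<close> by (auto simp: black_white_adj_def)
  ultimately show "e \<in> grid_edges" unfolding grid_edges_def by blast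
qed

lemma card_exact_covers_shift:
  "card (exact_covers grid_edges (shift ` V)) = card (exact_covers grid_edges V)"
  using inj_shift shift_image_grid_edges by (rule card_exact_covers_image)

section \<open>Cells of the grid\<close>

text \<open>The 4-cycle around the point (2i+1, 2j+1) in the placement used for
  \<open>shift\<close>. The cells are every other face of the grid, as the squares of one colour on
  a chessboard.\<close>

definition cell :: "nat \<times> nat \<Rightarrow> vertex set set" where
  "cell = (\<lambda>(i, j). {{Black i j, White i j}, {Black i (j + 1), White i j},
     {Black i j, White (i + 1) j}, {Black i (j + 1), White (i + 1) j}})"

lemma Union_cell:
  "\<Union>(cell (i, j)) = {White i j, White (i + 1) j, Black i j, Black i (j + 1)}"
  by (auto simp: cell_def)

text \<open>An edge determines its cell: the first index comes from its black end, the second from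
  its white end. Hence the cells partition the edges.\<close>

lemma edge_in_cell:
  "{Black i j, White k l} \<in> cell (p, q) \<longleftrightarrow>
    i = p \<and> l = q \<and> black_white_adj (i, j) (k, l)"
  by (auto simp: cell_def black_white_adj_def doubleton_eq_iff)

lemma cell_subset_grid_edges: "cell c \<subseteq> grid_edges"
proof
  fix e assume "e \<in> cell c"
  moreover obtain p q where c: "c = (p, q)" by force
  ultimately obtain i j k l where e: "e = {Black i j, White k l}"
    unfolding c cell_def by auto
  then have "black_white_adj (i, j) (k, l)"
    using \<open>e \<in> cell c\<close> by (auto simp: c edge_in_cell)
  then show "e \<in> grid_edges" unfolding e grid_edges_def by blast
qed

lemma disjoint_family_cell: "disjoint_family_on cell I"
  unfolding disjoint_family_on_def
proof (intro ballI impI equals0I)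
  fix c d e assume *: "c \<noteq> d" "e \<in> cell c \<inter> cell d"
  then have "e \<in> grid_edges" using cell_subset_grid_edges by blast
  then obtain i j k l where e: "e = {Black i j, White k l}"
    by (auto simp: grid_edges_def)
  show False
    using * by (cases c; cases d) (simp add: e edge_in_cell)
qed

lemma finite_verts_aztec_graph:
  "finite W \<Longrightarrow> finite B \<Longrightarrow> finite (verts (aztec_graph W B))"
  by (simp add: aztec_graph_def)

section \<open>Complementation inside a box of \<open>p\<close> by \<open>q\<close> cells\<close>

lemma exact_covers_cells:
  assumes "V \<subseteq> verts (aztec_graph {(i, j). i \<le> p \<and> j < q} {(i, j). i < p \<and> j \<le> q})"
  shows "exact_covers (\<Union>c\<in>{..<p} \<times> {..<q}. cell c) V = exact_covers grid_edges V"
proof (rule exact_covers_cong)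
  fix e assume "e \<subseteq> V"
  show "e \<in> (\<Union>c\<in>{..<p} \<times> {..<q}. cell c) \<longleftrightarrow> e \<in> grid_edges"
  proof
    assume "e \<in> grid_edges"
    then obtain i j k l where e: "e = {Black i j, White k l}" "black_white_adj (i, j) (k, l)"
      by (auto simp: grid_edges_def)
    then have "{Black i j, White k l}
        \<subseteq> verts (aztec_graph {(i, j). i \<le> p \<and> j < q} {(i, j). i < p \<and> j \<le> q})"
      using assms \<open>e \<subseteq> V\<close> by blast
    \<comment> \<open>The bounds on the black first index and on the white second index are exactly
      those that put the cell \<open>(i, l)\<close> in the box.\<close>
    then have "i < p" "l < q" by simp_all
    then show "e \<in> (\<Union>c\<in>{..<p} \<times> {..<q}. cell c)"
      using e by (intro UN_I[of "(i, l)"]) (simp_all add: edge_in_cell)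
  qed (use cell_subset_grid_edges in blast)
qed

text \<open>The two cells at \<open>w(i,j)\<close> are \<open>(i, j)\<close> and
  \<open>(i - 1, j)\<close>; on the sides \<open>i = 0\<close> and \<open>i = p\<close> only one of
  them belongs to the box.\<close>

lemma card_cells_containing_White:
  "card {c \<in> {..<p} \<times> {..<q}. White i j \<in> \<Union>(cell c)}
    = of_bool (i < p \<and> j < q) + of_bool (1 \<le> i \<and> i \<le> p \<and> j < q)"
proof -
  have "{c \<in> {..<p} \<times> {..<q}. White i j \<in> \<Union>(cell c)}
      = (if i < p \<and> j < q then {(i, j)} else {}) \<union>
        (if 1 \<le> i \<and> i \<le> p \<and> j < q then {(i - 1, j)} else {})" (is "?L = ?R")
  proof (rule set_eqI)
    fix c :: "nat \<times> nat"
    obtain k l where c: "c = (k, l)" by force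
    show "c \<in> ?L \<longleftrightarrow> c \<in> ?R"
      unfolding c mem_Collect_eq Union_cell by auto
  qed
  then show ?thesis by auto
qed

lemma card_cells_containing_Black:
  "card {c \<in> {..<p} \<times> {..<q}. Black i j \<in> \<Union>(cell c)}
    = of_bool (i < p \<and> j < q) + of_bool (i < p \<and> 1 \<le> j \<and> j \<le> q)"
proof -
  have "{c \<in> {..<p} \<times> {..<q}. Black i j \<in> \<Union>(cell c)}
      = (if i < p \<and> j < q then {(i, j)} else {}) \<union>
        (if i < p \<and> 1 \<le> j \<and> j \<le> q then {(i, j - 1)} else {})" (is "?L = ?R")
  proof (rule set_eqI)
    fix c :: "nat \<times> nat"
    obtain k l where c: "c = (k, l)" by force
    show "c \<in> ?L \<longleftrightarrow> c \<in> ?R"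
      unfolding c mem_Collect_eq Union_cell by auto
  qed
  then show ?thesis by auto
qed

text \<open>\<open>V\<close> is the box with the holes \<open>D\<close> on the side
  \<open>i = 0\<close>. Vertices on the sides lie in a single cell and are switched: the other three
  sides disappear, and on \<open>i = 0\<close> only the holes appear. With \<open>p * q\<close>
  cells and \<open>p * (q + 1)\<close> black vertices in \<open>V\<close>, the power
  \<open>2 ^ p\<close> remains.\<close>

lemma grid_complementation:
  fixes p q :: nat and D :: "nat set"
  assumes "1 \<le> p" "1 \<le> q"
  defines "V \<equiv> verts (aztec_graph {(i, j). i \<le> p \<and> j < q \<and> \<not> (i = 0 \<and> j \<in> D)}
      {(i, j). i < p \<and> j \<le> q})"
  defines "V' \<equiv> verts (aztec_graph {(i, j). i < p \<and> j < q \<and> (i = 0 \<longrightarrow> j \<in> D)}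
      {(i, j). i < p \<and> 1 \<le> j \<and> j < q})"
  shows "card (exact_covers grid_edges V) = 2 ^ p * card (exact_covers grid_edges V')"
proof -
  let ?I = "{..<p} \<times> {..<q}" and ?B = "range (\<lambda>(i, j). Black i j)"
  let ?box = "verts (aztec_graph {(i, j). i \<le> p \<and> j < q} {(i, j). i < p \<and> j \<le> q})"
  have "x \<in> ?box" if "x \<in> V \<or> x \<in> V'" for x
    using that by (cases x) (auto simp: V_def V'_def)
  then have sub: "V \<subseteq> ?box" "V' \<subseteq> ?box" by blast+
  have "finite ({..p} \<times> {..q})" by simp
  then have "finite ?box"
    by (intro finite_verts_aztec_graph; elim finite_subset[rotated]) auto
  then have fin: "finite V" "finite V'" using sub finite_subset by blast+
  have "2 ^ card ?I * card (exact_covers (\<Union>c\<in>?I. cell c) V)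
      = 2 ^ card (V \<inter> ?B) * card (exact_covers (\<Union>c\<in>?I. cell c) V')"
  proof (rule complementation[OF _ fin disjoint_family_cell])
    show "card {c \<in> ?I. x \<in> \<Union>(cell c)} = of_bool (x \<in> V) + of_bool (x \<in> V')" for x
    proof (cases x)
      case (White i j)
      then show ?thesis
        unfolding White card_cells_containing_White V_def V'_def using assms(1)
        by (auto simp: of_bool_def)
    next
      case (Black i j)
      then show ?thesis
        unfolding Black card_cells_containing_Black V_def V'_def using assms(2)
        by (auto simp: of_bool_def)
    qed
    show "2 * card (exact_covers (cell c) U)
        = 2 ^ card (U \<inter> ?B) * card (exact_covers (cell c) (\<Union>(cell c) - U))"
      if "U \<subseteq> \<Union>(cell c)" for c U
    proof -
      obtain i j where c: "c = (i, j)" by force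
      have "U \<subseteq> {White i j, White (i + 1) j, Black i j, Black i (j + 1)}"
        using that by (simp only: c Union_cell)
      moreover have "?B \<inter> {White i j, White (i + 1) j, Black i j, Black i (j + 1)}
          = {Black i j, Black i (j + 1)}" by auto
      ultimately show ?thesis
        using card_exact_covers_square[of "White i j" "White (i + 1) j" "Black i j"
            "Black i (j + 1)" U ?B]
        unfolding c Union_cell by (simp add: cell_def)
    qed
  qed simp
  \<comment> \<open>All holes are white, so \<open>V\<close> contains every black vertex of the
    box.\<close>
  moreover have "V \<inter> ?B = (\<lambda>(i, j). Black i j) ` ({..<p} \<times> {..q})"
    by (rule vertex_set_eqI) (auto simp: V_def)
  then have "card (V \<inter> ?B) = p * q + p"
    by (simp add: card_image inj_on_def)
  ultimately have "2 ^ (p * q) * card (exact_covers grid_edges V)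
      = 2 ^ (p * q) * (2 ^ p * card (exact_covers grid_edges V'))"
    by (simp add: sub[THEN exact_covers_cells] power_add mult.assoc)
  then show ?thesis by simp
qed

section \<open>Aztec diamonds and rectangles\<close>

text \<open>The diamond is a square box without holes; stripping its four sides leaves the next
  smaller diamond, translated by \<open>shift\<close>.\<close>

lemma num_perfect_matchings_aztec_diamond_Suc:
  "num_perfect_matchings (aztec_diamond (Suc m))
    = 2 ^ Suc m * num_perfect_matchings (aztec_diamond m)"
proof -
  have "verts (aztec_graph {(i, j). i < Suc m \<and> j < Suc m \<and> (i = 0 \<longrightarrow> j \<in> {})}
      {(i, j). i < Suc m \<and> 1 \<le> j \<and> j < Suc m}) = shift ` verts (aztec_diamond m)"
    by (rule vertex_set_eqI)
      (auto simp: White_in_shift Black_in_shift aztec_diamond_def)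
  then show ?thesis
    using grid_complementation[of "Suc m" "Suc m" "{}"]
    by (simp add: aztec_diamond_def num_perfect_matchings_aztec_graph card_exact_covers_shift)
qed

lemma num_perfect_matchings_aztec_diamond_pos: "num_perfect_matchings (aztec_diamond m) > 0"
proof (induction m)
  case 0
  have "{M. perfect_matching (aztec_diamond 0) M} = {{}}"
    by (auto simp: perfect_matching_def aztec_diamond_def aztec_graph_def)
  then show ?case by (simp add: num_perfect_matchings_def)
qed (simp add: num_perfect_matchings_aztec_diamond_Suc)

lemma aztec_rectangle_hole_eq:
  "aztec_rectangle_hole m a 0 =
    aztec_graph {(i, j). i \<le> m \<and> j < Suc m \<and> \<not> (i = 0 \<and> j \<in> {a})} {(i, j). i < m \<and> j \<le> Suc m}"
proof -
  have "{(i, j). i \<le> m \<and> j \<le> m} - {(0, a)}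
      = {(i, j). i \<le> m \<and> j < Suc m \<and> \<not> (i = 0 \<and> j \<in> {a})}" by auto
  then show ?thesis
    by (simp add: aztec_rectangle_hole_def aztec_rectangle_def delete_White_aztec_graph)
qed

text \<open>The complement is a shifted smaller rectangle plus the former hole
  \<open>w(0,a)\<close>, which can be matched to \<open>v(0,a)\<close> or \<open>v(0,a+1)\<close>.
  As \<open>shift\<close> sends \<open>w(0,j-1)\<close> to \<open>v(0,j)\<close>, these choices
  leave holes at \<open>a - 1\<close> and \<open>a\<close>.\<close>

lemma num_perfect_matchings_aztec_rectangle_hole_Suc:
  assumes "1 \<le> a" "a \<le> Suc m"
  shows "num_perfect_matchings (aztec_rectangle_hole (Suc m) a 0)
    = 2 ^ Suc m * ((if a = Suc m then 0 else num_perfect_matchings (aztec_rectangle_hole m a 0))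
        + num_perfect_matchings (aztec_rectangle_hole m (a - 1) 0))"
proof -
  let ?V = "verts (aztec_graph
      {(i, j). i < Suc m \<and> j < Suc (Suc m) \<and> (i = 0 \<longrightarrow> j \<in> {a})}
      {(i, j). i < Suc m \<and> 1 \<le> j \<and> j < Suc (Suc m)})"
  let ?N = "\<lambda>V. card (exact_covers grid_edges V)"
  let ?e = "\<lambda>j. {Black 0 j, White 0 a}"
  have "finite ({..Suc m} \<times> {..Suc m})" by simp
  then have "finite ?V"
    by (intro finite_verts_aztec_graph; elim finite_subset[rotated]) auto
  then have "?N ?V = (\<Sum>e | e \<in> grid_edges \<and> White 0 a \<in> e \<and> e \<subseteq> ?V. ?N (?V - e))"
    by (rule card_exact_covers_at) (use assms in simp)
  \<comment> \<open>\<open>1 \<le> a\<close> keeps \<open>v(0,a)\<close> in \<open>?V\<close>. For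
    \<open>a = Suc m\<close> the neighbour \<open>v(0,a+1)\<close> falls on the stripped side, which
    accounts for the zero term.\<close>
  also have "{e. e \<in> grid_edges \<and> White 0 a \<in> e \<and> e \<subseteq> ?V}
      = insert (?e a) (if a = Suc m then {} else {?e (a + 1)})"
  proof (intro subset_antisym subsetI)
    fix e assume "e \<in> {e. e \<in> grid_edges \<and> White 0 a \<in> e \<and> e \<subseteq> ?V}"
    then obtain i j where "e = {Black i j, White 0 a}" "black_white_adj (i, j) (0, a)"
      "Black i j \<in> ?V"
      by (auto simp: grid_edges_def)
    then show "e \<in> insert (?e a) (if a = Suc m then {} else {?e (a + 1)})"
      by (auto simp: black_white_adj_def)
  next
    fix e assume "e \<in> insert (?e a) (if a = Suc m then {} else {?e (a + 1)})"
    then obtain j where j: "e = ?e j" "j = a \<or> a < Suc m \<and> j = a + 1"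
      using assms by (auto split: if_splits)
    then have "black_white_adj (0, j) (0, a)" by (auto simp: black_white_adj_def)
    then have "e \<in> grid_edges" unfolding grid_edges_def j(1) by blast
    then show "e \<in> {e. e \<in> grid_edges \<and> White 0 a \<in> e \<and> e \<subseteq> ?V}"
      using j assms by auto
  qed
  also have "(\<Sum>e\<in>\<dots>. ?N (?V - e))
      = (if a = Suc m then 0 else ?N (?V - ?e (a + 1))) + ?N (?V - ?e a)"
    by (simp add: doubleton_eq_iff)
  finally have "?N ?V = \<dots>" .
  moreover have "?N (?V - ?e j) = num_perfect_matchings (aztec_rectangle_hole m (j - 1) 0)"
    if "1 \<le> j" for j
  proof -
    have "?V - ?e j = shift ` verts (aztec_rectangle_hole m (j - 1) 0)"
      unfolding aztec_rectangle_hole_eq using that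
      by (intro vertex_set_eqI) (auto simp: White_in_shift Black_in_shift)
    then show ?thesis
      unfolding aztec_rectangle_hole_eq
      by (simp only: card_exact_covers_shift num_perfect_matchings_aztec_graph)
  qed
  ultimately have "?N ?V
      = (if a = Suc m then 0 else num_perfect_matchings (aztec_rectangle_hole m a 0))
        + num_perfect_matchings (aztec_rectangle_hole m (a - 1) 0)"
    using assms(1) by simp
  then show ?thesis
    \<comment> \<open>The rectangle is one cell longer than the diamond only in the \<open>q\<close>
      direction, so the power \<open>2 ^ p\<close> is the same for both.\<close>
    using grid_complementation[of "Suc m" "Suc (Suc m)" "{a}"]
    unfolding aztec_rectangle_hole_eq[of "Suc m"] num_perfect_matchings_aztec_graph by simp
qed

theorem theorem4p2:
  fixes n a :: nat
  assumes "1 \<le> n" and "1 \<le> a" and "a \<le> n"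
  shows "T (aztec_rectangle_hole n a 0) =
    ((if a = n then 0 else T (aztec_rectangle_hole (n - 1) a 0)) * T (aztec_diamond n)
      + T (aztec_rectangle_hole (n - 1) (a - 1) 0) * T (aztec_diamond n))
    / T (aztec_diamond (n - 1))"
proof -
  obtain m where n: "n = Suc m" using assms(1) by (cases n) auto
  \<comment> \<open>The quotient of the two diamond counts is \<open>2 ^ n\<close>, the factor in
    the recurrence for the rectangles; the division requires a nonzero denominator.\<close>
  have "T (aztec_diamond m) \<noteq> 0"
    using num_perfect_matchings_aztec_diamond_pos[of m] by simp
  then show ?thesis
    using assms
    by (simp add: n num_perfect_matchings_aztec_diamond_Suc field_simps
        num_perfect_matchings_aztec_rectangle_hole_Suc)
qed

end
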